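(* Let $\mathbf{k}$ be an associative ring with unity $1\neq 0$. Let $X=X_1\amalg X_2$ be a quandle, where $X_1$ is an orbit of $X$ with $1<|X_1|<\infty$. Then $\mathbf{k}[X]$ is not a domain.
   Context: A quandle is a set $X$ with a binary operation $\triangleright$ such that: (I) $a\triangleright a=a$ for all $a\in X$; (II) for all $a,b\in X$ there is a unique $c\in X$ with $a=c\triangleright b$; (III) $(a\triangleright b)\triangleright c=(a\triangleright c)\triangleright(b\triangleright c)$ for all $a,b,c\in X$. For $x\in X$ let $R_x:X\to X$, $y\mapsto y\triangleright x$ (a bijection), and let $\operatorname{Inn}(X)$ be the group generated by all $R_x$, $x\in X$. An orbit of $X$ is an orbit of $\operatorname{Inn}(X)$ acting on $X$. Here $X_2=X\setminus X_1$. The quandle ring $\mathbf{k}[X]$ is the set of finite formal sums $\sum_{x\in X}a_x x$, $a_x\in\mathbf{k}$, with the natural addition and the (generally nonassociative) multiplication $\left(\sum_{x}a_x x\right)\cdot\left(\sum_{y}b_y y\right)=\sum_{x,y}a_xb_y\,(x\triangleright y)$. It is a domain if $u\cdot v=0$ implies $u=0$ or $v=0$. *)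

theory Defs
  imports
    "HOL-Library.Poly_Mapping"
    "HOL-Algebra.Bij"
    "HOL-Algebra.Group_Action"
    "HOL-Algebra.Elementary_Groups"
begin

locale quandle =
  fixes X :: "'a set" and qop :: "'a \<Rightarrow> 'a \<Rightarrow> 'a" (infixl "\<triangleright>" 70)
  assumes closed: "\<lbrakk>a \<in> X; b \<in> X\<rbrakk> \<Longrightarrow> a \<triangleright> b \<in> X"
    and idem: "a \<in> X \<Longrightarrow> a \<triangleright> a = a"
    and right_div: "\<lbrakk>a \<in> X; b \<in> X\<rbrakk> \<Longrightarrow> \<exists>!c. c \<in> X \<and> a = c \<triangleright> b"
    and right_distrib: "\<lbrakk>a \<in> X; b \<in> X; c \<in> X\<rbrakk> \<Longrightarrow> (a \<triangleright> b) \<triangleright> c = (a \<triangleright> c) \<triangleright> (b \<triangleright> c)"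

text \<open>The map \<open>y \<mapsto> y \<triangleright> x\<close>, made extensional on \<open>X\<close> because the elements of
  \<^const>\<open>BijGroup\<close> are extensional functions.\<close>

definition right_mult :: "'a set \<Rightarrow> ('a \<Rightarrow> 'a \<Rightarrow> 'a) \<Rightarrow> 'a \<Rightarrow> 'a \<Rightarrow> 'a" where
  "right_mult X qop x = (\<lambda>y\<in>X. qop y x)"

definition Inn :: "'a set \<Rightarrow> ('a \<Rightarrow> 'a \<Rightarrow> 'a) \<Rightarrow> ('a \<Rightarrow> 'a) monoid" where
  "Inn X qop = subgroup_generated (BijGroup X) (right_mult X qop ` X)"

definition quandle_orbits :: "'a set \<Rightarrow> ('a \<Rightarrow> 'a \<Rightarrow> 'a) \<Rightarrow> 'a set set" where
  "quandle_orbits X qop = orbits (Inn X qop) X (\<lambda>g. g)"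

text \<open>\<^const>\<open>subgroup_generated\<close> intersects its generating set with the carrier; the first lemma
  shows that no generator is lost.\<close>

lemma (in quandle) right_mult_in_BijGroup:
  assumes "x \<in> X"
  shows "right_mult X (\<triangleright>) x \<in> carrier (BijGroup X)"
proof -
  have "bij_betw (\<lambda>y. y \<triangleright> x) X X"
    unfolding bij_betw_def
  proof
    show "inj_on (\<lambda>y. y \<triangleright> x) X"
    proof (rule inj_onI)
      fix a b
      assume ab: "a \<in> X" "b \<in> X" "a \<triangleright> x = b \<triangleright> x"
      show "a = b"
        using right_div[OF closed[OF ab(1) assms] assms] ab by blast
    qed
    show "(\<lambda>y. y \<triangleright> x) ` X = X"
    proof
      show "(\<lambda>y. y \<triangleright> x) ` X \<subseteq> X"
        using closed[OF _ assms] by blast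
      show "X \<subseteq> (\<lambda>y. y \<triangleright> x) ` X"
        using right_div[OF _ assms] by blast
    qed
  qed
  then have "bij_betw (right_mult X (\<triangleright>) x) X X"
    unfolding right_mult_def using bij_betw_restrict_eq by blast
  then show ?thesis
    by (simp add: BijGroup_def Bij_def right_mult_def)
qed

lemma group_action_Inn: "group_action (Inn X qop) X (\<lambda>g. g)"
proof -
  interpret B: group "BijGroup X"
    by (rule group_BijGroup)
  have "group (Inn X qop)"
    unfolding Inn_def by (rule B.group_subgroup_generated)
  moreover have "(\<lambda>g. g) \<in> hom (Inn X qop) (BijGroup X)"
    unfolding Inn_def hom_def
    using B.carrier_subgroup_generated_subset by auto
  ultimately show ?thesis
    by (simp add: group_action_def group_hom_def group_hom_axioms_def group_BijGroup)
qed

text \<open>The quandle ring \<open>k[X]\<close>: finitely supported functions with support in \<open>X\<close>. Zero and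
  addition are those of \<^typ>\<open>'a \<Rightarrow>\<^sub>0 'k\<close>; the multiplication is not the one of that type,
  which comes from an addition on \<^typ>\<open>'a\<close>.\<close>

definition quandle_ring :: "'a set \<Rightarrow> ('a \<Rightarrow>\<^sub>0 'k::ring_1) set" where
  "quandle_ring X = {u. Poly_Mapping.keys u \<subseteq> X}"

definition quandle_ring_mult ::
  "('a \<Rightarrow> 'a \<Rightarrow> 'a) \<Rightarrow> ('a \<Rightarrow>\<^sub>0 'k::ring_1) \<Rightarrow> ('a \<Rightarrow>\<^sub>0 'k) \<Rightarrow> ('a \<Rightarrow>\<^sub>0 'k)" where
  "quandle_ring_mult qop u v =
    (\<Sum>x\<in>Poly_Mapping.keys u. \<Sum>y\<in>Poly_Mapping.keys v.
      Poly_Mapping.single (qop x y) (Poly_Mapping.lookup u x * Poly_Mapping.lookup v y))"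

definition quandle_ring_domain :: "'k::ring_1 itself \<Rightarrow> 'a set \<Rightarrow> ('a \<Rightarrow> 'a \<Rightarrow> 'a) \<Rightarrow> bool" where
  "quandle_ring_domain (_ :: 'k itself) X qop \<longleftrightarrow>
    (\<forall>u\<in>quandle_ring X. \<forall>v\<in>quandle_ring X.
      quandle_ring_mult qop u v = (0 :: 'a \<Rightarrow>\<^sub>0 'k) \<longrightarrow> u = 0 \<or> v = 0)"

end

theory Submission
  imports Defs
begin

text \<open>Every right multiplication permutes the finite orbit \<open>X\<^sub>1\<close>, hence fixes the sum \<open>w\<close> of its
  elements. So \<open>w \<cdot> (a - b) = w - w = 0\<close> for any two distinct elements \<open>a\<close>, \<open>b\<close> of \<open>X\<^sub>1\<close>.\<close>

lemma (in quandle) inj_on_right_mult: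
  assumes "y \<in> X"
  shows "inj_on (\<lambda>x. x \<triangleright> y) X"
proof (rule inj_onI)
  fix a b
  assume "a \<in> X" "b \<in> X" "a \<triangleright> y = b \<triangleright> y"
  then show "a = b"
    using right_div[OF closed[OF _ assms] assms, of a] by blast
qed

lemma (in quandle) right_mult_in_Inn:
  assumes "y \<in> X"
  shows "right_mult X (\<triangleright>) y \<in> carrier (Inn X (\<triangleright>))"
  using assms right_mult_in_BijGroup
  by (auto simp: Inn_def carrier_subgroup_generated intro: generate.incl)

text \<open>Elements of \<open>Inn X qop\<close> act as bijections of \<open>X\<close>, so a point
  of \<open>X\<close> never leaves it.\<close>

lemma quandle_orbit_subset:
  assumes "A \<in> quandle_orbits X qop"
  shows "A \<subseteq> X"
proof -
  interpret group_action "Inn X qop" X "\<lambda>g. g" by (rule group_action_Inn)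
  show ?thesis
    using assms element_image[OF _ _ refl]
    by (auto simp: quandle_orbits_def orbits_def orbit_def)
qed

text \<open>Right multiplication by \<open>y\<close> is itself an element of \<open>Inn\<close>.
  Composing it with a group element that carries the base point \<open>z\<close> to \<open>x\<close>
  gives one that carries \<open>z\<close> to \<open>x \<triangleright> y\<close>.\<close>

lemma (in quandle) quandle_orbit_closed:
  assumes "A \<in> quandle_orbits X (\<triangleright>)" "x \<in> A" "y \<in> X"
  shows "x \<triangleright> y \<in> A"
proof -
  interpret act: group_action "Inn X (\<triangleright>)" X "\<lambda>g. g" by (rule group_action_Inn)
  interpret G: group "Inn X (\<triangleright>)"
    using act.group_hom by (simp add: group_hom_def)
  obtain z where z: "z \<in> X" and A: "A = orbit (Inn X (\<triangleright>)) (\<lambda>g. g) z"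
    using assms(1) by (auto simp: quandle_orbits_def orbits_def)
  obtain g where g: "g \<in> carrier (Inn X (\<triangleright>))" "x = g z"
    using assms(2) A by (auto simp: orbit_def)
  let ?r = "right_mult X (\<triangleright>) y"
  \<comment> \<open>\<open>right_mult\<close> is extensional and agrees with the quandle operation
    only on \<open>X\<close>, so \<open>x\<close> must first be known to lie in
    \<open>X\<close>.\<close>
  have "x \<triangleright> y = ?r x"
    using assms quandle_orbit_subset by (auto simp: right_mult_def)
  also have "\<dots> = (?r \<otimes>\<^bsub>Inn X (\<triangleright>)\<^esub> g) z"
    using act.composition_rule[OF z right_mult_in_Inn[OF assms(3)] g(1)] g(2) by simp
  finally show ?thesis
    using A g(1) right_mult_in_Inn[OF assms(3)] by (auto simp: orbit_def)
qed

text \<open>The restricted map is injective and preserves \<open>A\<close>; finiteness of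
  \<open>A\<close> then forces surjectivity.\<close>

lemma (in quandle) bij_betw_right_mult_orbit:
  assumes "A \<in> quandle_orbits X (\<triangleright>)" "finite A" "y \<in> X"
  shows "bij_betw (\<lambda>x. x \<triangleright> y) A A"
proof -
  have inj: "inj_on (\<lambda>x. x \<triangleright> y) A"
    using inj_on_subset[OF inj_on_right_mult quandle_orbit_subset] assms by blast
  moreover have "(\<lambda>x. x \<triangleright> y) ` A \<subseteq> A"
    using quandle_orbit_closed assms by blast
  ultimately show ?thesis
    using endo_inj_surj[OF assms(2)] by (simp add: bij_betw_def)
qed

lemma lookup_sum_single:
  assumes "finite A"
  shows "Poly_Mapping.lookup (\<Sum>x\<in>A. Poly_Mapping.single x c) y = (c when y \<in> A)"
  using assms by (simp add: lookup_sum lookup_single when_def)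

lemma keys_sum_single:
  assumes "finite A" "c \<noteq> 0"
  shows "Poly_Mapping.keys (\<Sum>x\<in>A. Poly_Mapping.single x c) = A"
  using assms by (auto simp: in_keys_iff lookup_sum_single when_def split: if_splits)

theorem proposition4p1:
  fixes X X\<^sub>1 X\<^sub>2 :: "'a set" and qop :: "'a \<Rightarrow> 'a \<Rightarrow> 'a"
  assumes "quandle X qop"
    and "X = X\<^sub>1 \<union> X\<^sub>2" and "X\<^sub>1 \<inter> X\<^sub>2 = {}"
    and "X\<^sub>1 \<in> quandle_orbits X qop"
    and "finite X\<^sub>1" and "1 < card X\<^sub>1"
  shows "\<not> quandle_ring_domain TYPE('k::ring_1) X qop"
proof -
  interpret quandle X qop by (rule assms(1))
  note fin = assms(5)
  obtain a b where ab: "a \<in> X\<^sub>1" "b \<in> X\<^sub>1" "a \<noteq> b"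
    using assms(6) card_le_Suc0_iff_eq[OF fin] by auto
  have sub: "X\<^sub>1 \<subseteq> X"
    using assms(2) by blast
  define w :: "'a \<Rightarrow>\<^sub>0 'k" where "w = (\<Sum>x\<in>X\<^sub>1. Poly_Mapping.single x 1)"
  define v :: "'a \<Rightarrow>\<^sub>0 'k" where "v = Poly_Mapping.single a 1 - Poly_Mapping.single b 1"
  have kw: "Poly_Mapping.keys w = X\<^sub>1"
    using fin by (simp add: w_def keys_sum_single)
  have lw: "Poly_Mapping.lookup w x = 1" if "x \<in> X\<^sub>1" for x
    using that fin by (simp add: w_def lookup_sum_single)
  have lv: "Poly_Mapping.lookup v a = 1" "Poly_Mapping.lookup v b = - 1"
    using ab by (simp_all add: v_def lookup_minus lookup_single)
  \<comment> \<open>Since \<open>a\<close> and \<open>b\<close> are distinct, the two terms of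
    \<open>v\<close> cannot cancel, and \<open>1 \<noteq> 0\<close> keeps both in the
    support.\<close>
  have kv: "Poly_Mapping.keys v = {a, b}"
    using ab by (auto simp: v_def in_keys_iff lookup_minus lookup_single when_def split: if_splits)
  \<comment> \<open>Reindexing along the permutation of the orbit: this says that \<open>w\<close>
    times any basis element \<open>y\<close> is \<open>w\<close> again.\<close>
  have perm: "(\<Sum>x\<in>X\<^sub>1. Poly_Mapping.single (qop x y) 1) = w" if "y \<in> X" for y
    unfolding w_def using bij_betw_right_mult_orbit[OF assms(4) fin that]
    by (rule sum.reindex_bij_betw)
  have "quandle_ring_mult qop w v
      = (\<Sum>x\<in>X\<^sub>1. Poly_Mapping.single (qop x a) 1 - Poly_Mapping.single (qop x b) 1)"
    unfolding quandle_ring_mult_def kw kv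
    \<comment> \<open>The inner sum runs over the two-element support of \<open>v\<close>; the
      coefficient \<open>- 1\<close> at \<open>b\<close> becomes the subtraction.\<close>
    using ab by (intro sum.cong) (simp_all add: lw lv single_uminus)
  also have "\<dots> = w - w"
    using ab sub perm by (simp add: sum_subtractf subset_iff)
  finally have "quandle_ring_mult qop w v = 0"
    by simp
  moreover have "w \<in> quandle_ring X" "v \<in> quandle_ring X"
    using kw kv ab sub by (auto simp: quandle_ring_def)
  \<comment> \<open>Both supports contain \<open>a\<close>, whereas zero has empty support.\<close>
  moreover have "w \<noteq> 0" "v \<noteq> 0"
    using kw kv ab by auto
  ultimately show ?thesis
    unfolding quandle_ring_domain_def by blast
qed

end
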